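(* Let $p$ be a prime and $n,\ell$ positive integers. Assume $p^n\equiv 1\pmod{\ell^2}$ and let $\theta$ be an element of $\mathbb{F}_{p^n}$ of (multiplicative) order $\ell$. Then $$f(x)=\sum_{i=1}^{\ell}x^{p^i}\prod_{j=1,\,j\neq i}^{\ell}\left(x^{(p^n-1)/\ell}-\theta^j\right)$$ is a permutation polynomial over $\mathbb{F}_{p^n}$ if and only if $\{ip^i \bmod \ell\mid i=0,\ldots,\ell-1\}=\mathbb{Z}_\ell$ (that is, these $\ell$ numbers form a complete set of residues modulo $\ell$).
   Context: A polynomial is a permutation polynomial (PP) over a finite field if it induces a bijection of that field to itself. $\mathbb{Z}_\ell$ denotes the integers modulo $\ell$. *)

theory Defs
  imports
    "HOL-Computational_Algebra.Polynomial"
    "HOL-Computational_Algebra.Primes"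
    "HOL-Number_Theory.Cong"
begin

definition permutation_polynomial :: "'a::{field,finite} poly \<Rightarrow> bool" where
  "permutation_polynomial f \<longleftrightarrow> bij (poly f)"

(* The value is 0 when no positive power of x is 1; in a finite field this only happens for x = 0. *)
definition mult_order :: "'a::field \<Rightarrow> nat" where
  "mult_order x =
     (if \<exists>k>0. x ^ k = 1 then LEAST k. k > 0 \<and> x ^ k = 1 else 0)"

end

theory Submission
  imports Defs
begin

text \<open>
  Put \<open>q = p\<^sup>n\<close> and \<open>s = (q - 1) / l\<close>. A nonzero \<open>x\<close> satisfies \<open>x\<^sup>s = \<theta>\<^sup>k\<close> for a unique
  \<open>k \<in> {1..l}\<close>, and then only the \<open>k\<close>-th summand of \<open>f\<close> survives. Dilating the
  \<open>l\<close>-th roots of unity by \<open>\<theta>\<^sup>k\<close> shows that the surviving product is \<open>C * \<theta>\<^bsup>k(l-1)\<^esup>\<close> with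
  \<open>C \<noteq> 0\<close> independent of \<open>k\<close>. As \<open>l\<close> divides \<open>s\<close>, we get \<open>f(x)\<^sup>s = C\<^sup>s * \<theta>\<^bsup>k p^k\<^esup>\<close>:
  on the fibres of \<open>x \<mapsto> x\<^sup>s\<close>, all of which are nonempty, \<open>f\<close> acts as \<open>k \<mapsto> k p\<^sup>k\<close> does on
  residues modulo \<open>l\<close>, and on each fibre \<open>f\<close> is a scaled power of the Frobenius map, hence
  injective.
\<close>

text \<open>Multiplication by \<open>x\<close> permutes the nonzero elements, so it leaves their
  product unchanged while scaling it by a power of \<open>x\<close>.\<close>

lemma finite_field_power_card_minus_1:
  fixes x :: "'a::{field,finite}"
  assumes "x \<noteq> 0"
  shows "x ^ (card (UNIV :: 'a set) - 1) = 1"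
proof -
  let ?U = "UNIV - {0} :: 'a set"
  have "bij_betw ((*) x) ?U ?U"
    by (rule bij_betw_byWitness[where f' = "\<lambda>y. y / x"]) (use assms in auto)
  then have "(\<Prod>y\<in>?U. x * y) = \<Prod>?U"
    by (rule prod.reindex_bij_betw)
  then have "x ^ card ?U * \<Prod>?U = \<Prod>?U"
    by (simp add: prod.distrib)
  moreover have "\<Prod>?U \<noteq> 0" by simp
  ultimately show ?thesis by (simp add: card_Diff_singleton)
qed

text \<open>The library proves this only for the class \<open>finite_field\<close>, of which the sort
  \<open>{field,finite}\<close> is not a subsort.\<close>

lemma finite_field_power_card_power:
  fixes x :: "'a::{field,finite}"
  shows "x ^ (card (UNIV :: 'a set) ^ k) = x"
proof -
  have "x ^ card (UNIV :: 'a set) = x"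
  proof (cases "x = 0")
    case False
    have "card (UNIV :: 'a set) = Suc (card (UNIV :: 'a set) - 1)"
      by (simp add: card_gt_0_iff)
    then have "x ^ card (UNIV :: 'a set) = x * x ^ (card (UNIV :: 'a set) - 1)"
      by (metis power_Suc)
    then show ?thesis using finite_field_power_card_minus_1[OF False] by simp
  qed (simp add: card_gt_0_iff)
  then show ?thesis
    by (induction k) (auto simp: power_mult)
qed

text \<open>A further power \<open>p ^ ((n - 1) * k)\<close> completes the exponent to
  \<open>(p ^ n) ^ k\<close>, which acts as the identity; this is a left inverse.\<close>

lemma inj_frobenius_power:
  assumes "card (UNIV :: 'a::{field,finite} set) = p ^ n" and "n > 0"
  shows "inj (\<lambda>x :: 'a. x ^ (p ^ k))"
proof (rule injI)
  fix x y :: 'a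
  assume "x ^ (p ^ k) = y ^ (p ^ k)"
  then have "(x ^ (p ^ k)) ^ (p ^ ((n - 1) * k)) = (y ^ (p ^ k)) ^ (p ^ ((n - 1) * k))"
    by simp
  moreover have "p ^ k * p ^ ((n - 1) * k) = (p ^ n) ^ k"
    using \<open>n > 0\<close> by (cases n) (simp_all add: power_mult power_add power_mult_distrib)
  ultimately show "x = y"
    by (metis assms(1) finite_field_power_card_power power_mult)
qed

lemma finite_roots_power_eq: "m > 0 \<Longrightarrow> finite {x :: 'a::field. x ^ m = a}"
  and card_roots_power_eq_le: "m > 0 \<Longrightarrow> card {x :: 'a::field. x ^ m = a} \<le> m"
proof -
  assume m: "m > 0"
  let ?P = "monom 1 m - [:a:]"
  have "coeff ?P m = 1"
    using m by (simp add: coeff_pCons split: nat.splits)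
  then have "?P \<noteq> 0" by force
  moreover have "degree ?P \<le> m"
    by (intro degree_diff_le) (auto simp: degree_monom_le)
  moreover have "{x. poly ?P x = 0} = {x. x ^ m = a}"
    by (simp add: poly_monom)
  ultimately show "finite {x. x ^ m = a}" "card {x. x ^ m = a} \<le> m"
    by (metis poly_roots_finite, metis card_poly_roots_bound order_trans)
qed

text \<open>Exponents reduce modulo \<open>l\<close> because \<open>x ^ l = 1\<close>; two distinct
  exponents below \<open>l\<close> with equal powers would differ by a positive exponent of 1
  smaller than the order.\<close>

lemma mult_order_power_eq_iff:
  assumes "mult_order x = l" and "l > 0"
  shows "x ^ a = x ^ b \<longleftrightarrow> [a = b] (mod l)"
proof -
  have ex: "\<exists>k>0. x ^ k = 1"
    using assms by (auto simp: mult_order_def split: if_splits)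
  then have l: "l = (LEAST k. k > 0 \<and> x ^ k = 1)"
    using assms by (simp add: mult_order_def)
  have one: "x ^ l = 1"
    unfolding l using LeastI_ex[OF ex] by simp
  then have "x \<noteq> 0" using \<open>l > 0\<close> by (auto simp: power_0_left)
  have red: "x ^ m = x ^ (m mod l)" for m
  proof -
    have "x ^ (l * (m div l) + m mod l) = x ^ (m mod l)"
      by (simp only: power_add power_mult one power_one mult_1)
    then show ?thesis by simp
  qed
  have le: "b \<le> a" if "a < l" "b < l" "x ^ a = x ^ b" for a b
  proof (rule ccontr)
    assume "\<not> b \<le> a"
    then have "x ^ a * x ^ (b - a) = x ^ b" by (simp flip: power_add)
    then have "x ^ (b - a) = 1" using that \<open>x \<noteq> 0\<close> by simp
    moreover have "b - a < (LEAST k. k > 0 \<and> x ^ k = 1)" using that l by linarith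
    ultimately show False using \<open>\<not> b \<le> a\<close> by (auto dest: not_less_Least)
  qed
  show ?thesis
    using red[of a] red[of b] le[of "a mod l" "b mod l"] le[of "b mod l" "a mod l"] \<open>l > 0\<close>
    by (auto simp: cong_def)
qed

lemma roots_of_unity_eq_powers:
  fixes x :: "'a::field"
  assumes "mult_order x = l" and "l > 0"
  shows "inj_on (\<lambda>j. x ^ j) {1..l}" and "{z. z ^ l = 1} = (\<lambda>j. x ^ j) ` {1..l}"
proof -
  note eq = mult_order_power_eq_iff[OF assms]
  show inj: "inj_on (\<lambda>j. x ^ j) {1..l}"
  proof (rule inj_onI)
    fix i j assume ij: "i \<in> {1..l}" "j \<in> {1..l}" "x ^ i = x ^ j"
    \<comment> \<open>Shifting down by one puts both exponents below \<open>l\<close>, where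
      congruence is equality.\<close>
    then have "[i - 1 + 1 = j - 1 + 1] (mod l)" by (simp add: eq)
    then have "[i - 1 = j - 1] (mod l)" by (simp only: cong_add_rcancel_nat)
    then have "i - 1 = j - 1"
      using ij by (intro cong_less_modulus_unique_nat[of "i - 1" "j - 1" l]) auto
    then show "i = j" using ij by auto
  qed
  have "(x ^ j) ^ l = 1" for j
    using eq[of "j * l" 0] by (simp add: cong_def flip: power_mult)
  then have "(\<lambda>j. x ^ j) ` {1..l} \<subseteq> {z. z ^ l = 1}" by auto
  moreover have "card {z :: 'a. z ^ l = 1} \<le> card ((\<lambda>j. x ^ j) ` {1..l})"
    unfolding card_image[OF inj] using card_roots_power_eq_le[OF \<open>l > 0\<close>] by simp
  ultimately show "{z. z ^ l = 1} = (\<lambda>j. x ^ j) ` {1..l}"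
    using card_seteq[OF finite_roots_power_eq[OF \<open>l > 0\<close>]] by metis
qed

text \<open>Each fibre of \<open>x \<mapsto> x\<^sup>s\<close> has at most \<open>s\<close> elements, so fewer than \<open>l\<close> nonempty fibres
  cannot cover all \<open>l s\<close> nonzero elements.\<close>

lemma power_surj_onto_roots_of_unity:
  fixes z :: "'a::{field,finite}"
  assumes "card (UNIV :: 'a set) - 1 = s * l" and "s > 0" and "l > 0" and "z ^ l = 1"
  obtains x where "x \<noteq> 0" and "x ^ s = z"
proof -
  let ?R = "{w :: 'a. w ^ l = 1}"
  have "\<exists>x. x ^ s = z"
  proof (rule ccontr)
    assume none: "\<not> (\<exists>x. x ^ s = z)"
    have "x ^ s \<in> ?R - {z}" if "x \<noteq> 0" for x
      using finite_field_power_card_minus_1[OF that] none assms(1) by (auto simp flip: power_mult)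
    then have "UNIV - {0} \<subseteq> (\<Union>w\<in>?R - {z}. {x. x ^ s = w})" by blast
    then have "card (UNIV - {0} :: 'a set) \<le> card (\<Union>w\<in>?R - {z}. {x. x ^ s = w})"
      by (intro card_mono) auto
    also have "\<dots> \<le> (\<Sum>w\<in>?R - {z}. card {x. x ^ s = w})"
      by (intro card_UN_le) auto
    also have "\<dots> \<le> card (?R - {z}) * s"
      using sum_bounded_above[of "?R - {z}" "\<lambda>w. card {x. x ^ s = w}" s,
          OF card_roots_power_eq_le[OF \<open>s > 0\<close>]] by simp
    \<comment> \<open>Strict because \<open>z\<close> is itself one of the at most \<open>l\<close>
      roots of unity and has been removed.\<close>
    also have "\<dots> < l * s"
    proof -
      have "card (?R - {z}) < card ?R"
        using assms by (intro psubset_card_mono) auto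
      then show ?thesis
        using card_roots_power_eq_le[OF \<open>l > 0\<close>, of "1 :: 'a"] \<open>s > 0\<close> by simp
    qed
    finally show False using assms(1) by (simp add: card_Diff_singleton mult.commute)
  qed
  then obtain x where x: "x ^ s = z" ..
  moreover have "z \<noteq> 0" using assms by (auto simp: power_0_left)
  ultimately have "x \<noteq> 0" using \<open>s > 0\<close> by (auto simp: power_0_left)
  then show ?thesis using x that by blast
qed

text \<open>Substituting \<open>z * w\<close> for \<open>w\<close> pulls one factor \<open>z\<close>
  out of each of the \<open>l - 1\<close> differences.\<close>

lemma prod_diff_roots_of_unity:
  fixes \<theta> z :: "'a::field"
  assumes "mult_order \<theta> = l" and "l > 0" and "z ^ l = 1"
  shows "(\<Prod>w\<in>{w. w ^ l = 1} - {z}. z - w) =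
         z ^ (l - 1) * (\<Prod>w\<in>{w. w ^ l = 1} - {1}. 1 - w)"
proof -
  let ?R = "{w :: 'a. w ^ l = 1}"
  have "z \<noteq> 0" using assms by (auto simp: power_0_left)
  have "card ?R = l"
    using card_image[OF roots_of_unity_eq_powers(1)[OF assms(1,2)]]
      roots_of_unity_eq_powers(2)[OF assms(1,2)] by simp
  then have card: "card (?R - {1}) = l - 1"
    by (simp add: card_Diff_singleton)
  have "bij_betw ((*) z) (?R - {1}) (?R - {z})"
    by (rule bij_betw_byWitness[where f' = "\<lambda>y. y / z"])
      (use \<open>z \<noteq> 0\<close> assms in \<open>auto simp: power_mult_distrib power_divide\<close>)
  then have "(\<Prod>w\<in>?R - {z}. z - w) = (\<Prod>w\<in>?R - {1}. z - z * w)"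
    by (rule prod.reindex_bij_betw[symmetric])
  also have "\<dots> = (\<Prod>w\<in>?R - {1}. z * (1 - w))"
    by (simp add: algebra_simps)
  finally show ?thesis by (simp add: prod.distrib card)
qed

theorem theorem2p27:
  fixes p n l :: nat
    and \<theta> :: "'a::{field,finite}"
    and f :: "'a poly"
  assumes "prime p"
    and "n > 0"
    and "l > 0"
    and "card (UNIV :: 'a set) = p ^ n"
    and "[p ^ n = 1] (mod l\<^sup>2)"
    and "mult_order \<theta> = l"
    and "f = (\<Sum>i=1..l. monom 1 (p ^ i) *
               (\<Prod>j\<in>{1..l} - {i}. monom 1 ((p ^ n - 1) div l) - [:\<theta> ^ j:]))"
  shows "permutation_polynomial f \<longleftrightarrow>
           (\<lambda>i. i * p ^ i mod l) ` {0..<l} = {0..<l}"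
proof -
  define s where "s = (p ^ n - 1) div l"
  define C where "C = (\<Prod>w\<in>{w :: 'a. w ^ l = 1} - {1}. 1 - w)"
  let ?h = "\<lambda>i. i * p ^ i mod l"
  note eq = mult_order_power_eq_iff[OF \<open>mult_order \<theta> = l\<close> \<open>l > 0\<close>]
  note roots = roots_of_unity_eq_powers[OF \<open>mult_order \<theta> = l\<close> \<open>l > 0\<close>]
  have "p > 1" using \<open>prime p\<close> by (rule prime_gt_1_nat)
  then have q: "p ^ n > 1" using \<open>n > 0\<close> by (rule one_less_power)
  have "l\<^sup>2 dvd p ^ n - 1"
    using \<open>[p ^ n = 1] (mod l\<^sup>2)\<close> by (rule cong_to_1_nat)
  then obtain t where t: "p ^ n - 1 = l\<^sup>2 * t" by (auto elim: dvdE)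
  \<comment> \<open>The square in the congruence is used here: \<open>l\<close> divides
    \<open>s\<close>, so \<open>s\<close>-th powers of powers of \<open>\<theta>\<close> are
    1.\<close>
  then have s: "s = l * t"
    using \<open>l > 0\<close> by (simp add: s_def power2_eq_square)
  have sl: "card (UNIV :: 'a set) - 1 = s * l"
    using t s \<open>card UNIV = p ^ n\<close> by (simp add: power2_eq_square)
  have "s > 0" using sl q \<open>card UNIV = p ^ n\<close> by (cases s) auto
  have "C \<noteq> 0" by (simp add: C_def)
  have "\<theta> \<noteq> 0"
    using eq[of l 0] \<open>l > 0\<close> by (auto simp: cong_def power_0_left)
  have \<theta>_s: "(\<theta> ^ m) ^ s = 1" for m
    using eq[of "m * s" 0] by (simp add: s cong_def flip: power_mult)

  have f_eval: "poly f x = (\<Sum>i=1..l. x ^ (p ^ i) * (\<Prod>j\<in>{1..l} - {i}. x ^ s - \<theta> ^ j))" for x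
    by (simp add: assms(7) poly_sum poly_prod poly_monom s_def)
  have f_0: "poly f 0 = 0"
    using \<open>p > 1\<close> by (simp add: f_eval power_0_left)
  have f_fibre: "poly f x = C * \<theta> ^ (k * (l - 1)) * x ^ (p ^ k)"
    if k: "k \<in> {1..l}" "x ^ s = \<theta> ^ k" for x k
  proof -
    have "poly f x = (\<Sum>i\<in>{k}. x ^ (p ^ i) * (\<Prod>j\<in>{1..l} - {i}. x ^ s - \<theta> ^ j))"
      unfolding f_eval
    proof (rule sum.mono_neutral_right)
      \<comment> \<open>For \<open>i \<noteq> k\<close> the product contains the vanishing factor
        \<open>j = k\<close>.\<close>
      show "\<forall>i\<in>{1..l} - {k}. x ^ (p ^ i) * (\<Prod>j\<in>{1..l} - {i}. x ^ s - \<theta> ^ j) = 0"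
        using k by (auto intro!: prod_zero bexI[of _ k])
    qed (use k in auto)
    also have "\<dots> = x ^ (p ^ k) * (\<Prod>j\<in>{1..l} - {k}. \<theta> ^ k - \<theta> ^ j)"
      by (simp add: k)
    also have "(\<Prod>j\<in>{1..l} - {k}. \<theta> ^ k - \<theta> ^ j) =
               (\<Prod>w\<in>(\<lambda>j. \<theta> ^ j) ` ({1..l} - {k}). \<theta> ^ k - w)"
      using inj_on_subset[OF roots(1)] by (subst prod.reindex) auto
    also have "(\<lambda>j. \<theta> ^ j) ` ({1..l} - {k}) = {w. w ^ l = 1} - {\<theta> ^ k}"
      using inj_on_image_set_diff[OF roots(1), of "{1..l}" "{k}"] k roots(2) by simp
    also have "(\<Prod>w\<in>{w. w ^ l = 1} - {\<theta> ^ k}. \<theta> ^ k - w) = (\<theta> ^ k) ^ (l - 1) * C"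
      unfolding C_def using k roots(2)
      by (intro prod_diff_roots_of_unity[OF \<open>mult_order \<theta> = l\<close> \<open>l > 0\<close>]) blast
    finally show ?thesis by (simp add: power_mult mult_ac)
  qed
  have fibre: "\<exists>k\<in>{1..l}. x ^ s = \<theta> ^ k" if "x \<noteq> 0" for x
    using finite_field_power_card_minus_1[OF that] sl roots(2)
    by (auto simp: power_mult)
  have f_s: "poly f x ^ s = C ^ s * \<theta> ^ (k * p ^ k)"
    if k: "k \<in> {1..l}" "x ^ s = \<theta> ^ k" for x k
  proof -
    have "(x ^ (p ^ k)) ^ s = (x ^ s) ^ (p ^ k)" by (simp add: mult.commute flip: power_mult)
    also have "\<dots> = \<theta> ^ (k * p ^ k)" by (simp add: k(2) power_mult)
    finally show ?thesis
      by (simp add: f_fibre[OF k] power_mult_distrib \<theta>_s)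
  qed
  have f_nz: "poly f x \<noteq> 0" if "x \<noteq> 0" for x
  proof -
    obtain k where "k \<in> {1..l}" "x ^ s = \<theta> ^ k" using fibre[OF \<open>x \<noteq> 0\<close>] ..
    from f_fibre[OF this] show ?thesis using \<open>C \<noteq> 0\<close> \<open>\<theta> \<noteq> 0\<close> \<open>x \<noteq> 0\<close> by simp
  qed

  \<comment> \<open>Fibres are indexed by \<open>{1..l}\<close>, residues by \<open>{0..<l}\<close>;
    the index \<open>l\<close> corresponds to 0, and \<open>?h\<close> is 0 at both.\<close>
  have h_mod: "?h (k mod l) = ?h k" if "k \<in> {1..l}" for k
    using that by (cases "k = l") auto

  show ?thesis
  proof
    assume "permutation_polynomial f"
    then have surj: "surj (poly f)"
      by (simp add: permutation_polynomial_def bij_is_surj)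
    show "?h ` {0..<l} = {0..<l}"
    proof
      show "?h ` {0..<l} \<subseteq> {0..<l}" using \<open>l > 0\<close> by auto
      show "{0..<l} \<subseteq> ?h ` {0..<l}"
      proof
        fix m assume m: "m \<in> {0..<l}"
        \<comment> \<open>The aim is a \<open>y\<close> in the fibre over
          \<open>C ^ s * \<theta> ^ m\<close>; the index of the fibre containing a preimage of
          \<open>y\<close> is then sent to \<open>m\<close> by \<open>?h\<close>.\<close>
        have "C ^ (s * l) = 1"
          using finite_field_power_card_minus_1[OF \<open>C \<noteq> 0\<close>] sl by simp
        moreover have "(\<theta> ^ m) ^ l = 1"
          using eq[of "m * l" 0] by (simp add: cong_def flip: power_mult)
        ultimately have "(C ^ s * \<theta> ^ m) ^ l = 1"
          by (simp add: power_mult_distrib power_mult)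
        then obtain y where y: "y \<noteq> 0" "y ^ s = C ^ s * \<theta> ^ m"
          using power_surj_onto_roots_of_unity[OF sl \<open>s > 0\<close> \<open>l > 0\<close>] by metis
        obtain x where x: "y = poly f x" using surj by (metis surjD)
        then have "x \<noteq> 0" using y f_0 by auto
        then obtain k where k: "k \<in> {1..l}" "x ^ s = \<theta> ^ k" using fibre by blast
        have "\<theta> ^ (k * p ^ k) = \<theta> ^ m"
          using f_s[OF k] y x \<open>C \<noteq> 0\<close> by simp
        then have "?h k = m" using eq m by (simp add: cong_def)
        then have "m = ?h (k mod l)" using h_mod[OF k(1)] by simp
        then show "m \<in> ?h ` {0..<l}"
            by (rule image_eqI) (use \<open>l > 0\<close> in simp)
      qed
    qed
  next
    assume h: "?h ` {0..<l} = {0..<l}"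
    then have inj_h: "inj_on ?h {0..<l}" by (intro eq_card_imp_inj_on) auto
    have "inj (poly f)"
    proof (rule injI)
      fix x y assume xy: "poly f x = poly f y"
      show "x = y"
      proof (cases "x = 0 \<or> y = 0")
        case True
        then show ?thesis using xy f_0 f_nz by metis
      next
        case False
        then obtain k m where k: "k \<in> {1..l}" "x ^ s = \<theta> ^ k"
          and m: "m \<in> {1..l}" "y ^ s = \<theta> ^ m"
          using fibre by metis
        \<comment> \<open>Comparing \<open>s\<close>-th powers of the two values first forces
          \<open>x\<close> and \<open>y\<close> into the same fibre; there \<open>f\<close> is a
          nonzero scalar times one Frobenius power.\<close>
        have "\<theta> ^ (k * p ^ k) = \<theta> ^ (m * p ^ m)"
          using f_s[OF k] f_s[OF m] xy \<open>C \<noteq> 0\<close> by simp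
        then have "?h (k mod l) = ?h (m mod l)"
          using eq h_mod k m by (simp add: cong_def)
        then have "k mod l = m mod l"
          using inj_h \<open>l > 0\<close> by (auto dest: inj_onD)
        then have "\<theta> ^ k = \<theta> ^ m" by (simp add: eq cong_def)
        then have "k = m" using roots(1) k m by (auto dest: inj_onD)
        then have "x ^ (p ^ k) = y ^ (p ^ k)"
          using f_fibre[OF k] f_fibre[OF m] xy \<open>C \<noteq> 0\<close> \<open>\<theta> \<noteq> 0\<close> by simp
        then show ?thesis
          using inj_frobenius_power[OF \<open>card UNIV = p ^ n\<close> \<open>n > 0\<close>] by (auto dest: injD)
      qed
    qed
    then show "permutation_polynomial f"
      by (simp add: permutation_polynomial_def bij_def finite_UNIV_inj_surj)
  qed
qed

end
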